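(* Let $n$ be a positive integer with $\gcd(n,6)=1$, let $G$ be a cyclic group of order $n$ and let $g\in G$ with $\mathrm{ord}(g)=n$. Let $x_1,x_2,x_3,x_4\in[1,n-1]$ be integers with $\gcd(n,x_1,x_2,x_3,x_4)=1$ such that $S=(x_1g)(x_2g)(x_3g)(x_4g)$ is a minimal zero-sum sequence over $G$, and suppose $\gcd(n,x_i)>1$ for some $i\in[1,4]$. Then $\mathrm{ind}(S)=1$.
   Context: $G$ is written additively. A sequence over $G$ is an unordered finite sequence of elements of $G$ with repetition allowed, written multiplicatively as $S=(n_1g)\cdot\ldots\cdot(n_kg)$. $S$ is a zero-sum sequence if the sum of its terms is $0$, and a minimal zero-sum sequence if it is a zero-sum sequence and no proper nontrivial subsequence has sum $0$. For a sequence $S$ over $G$, writing $S=(n_1h)\cdot\ldots\cdot(n_kh)$ with $1\le n_1,\dots,n_k\le |G|$ for a generator $h$ of $G$, set $\|S\|_h=(n_1+\cdots+n_k)/\mathrm{ord}(h)$; the index is $\mathrm{ind}(S)=\min\{\|S\|_h : h\in G,\ \langle h\rangle=G\}$. For integers $a\le b$, $[a,b]=\{x\in\mathbb{Z}: a\le x\le b\}$. *)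

theory Defs
  imports Complex_Main "HOL-Library.Multiset" "HOL-Algebra.Algebra"
begin

text \<open>
  The cyclic group, written additively on paper, is a HOL-Algebra group and hence written
  multiplicatively: the sum of terms is a product, \<open>k g\<close> is \<open>g [^] k\<close>, and \<open>0\<close> is \<open>\<one>\<close>.
  A sequence over \<open>G\<close> (unordered, finite, repetition allowed) is a multiset of elements of
  the carrier, and a subsequence is a submultiset.
\<close>

(* The sum of the terms of S: each distinct term a contributes a^m, m its multiplicity. *)
definition seq_sum :: "('a, 'b) monoid_scheme \<Rightarrow> 'a multiset \<Rightarrow> 'a" where
  "seq_sum G S = finprod G (\<lambda>a. a [^]\<^bsub>G\<^esub> count S a) (set_mset S)"

definition zero_sum :: "('a, 'b) monoid_scheme \<Rightarrow> 'a multiset \<Rightarrow> bool" where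
  "zero_sum G S \<longleftrightarrow> set_mset S \<subseteq> carrier G \<and> seq_sum G S = \<one>\<^bsub>G\<^esub>"

definition minimal_zero_sum :: "('a, 'b) monoid_scheme \<Rightarrow> 'a multiset \<Rightarrow> bool" where
  "minimal_zero_sum G S \<longleftrightarrow>
     zero_sum G S \<and> (\<forall>T. T \<subset># S \<and> T \<noteq> {#} \<longrightarrow> \<not> zero_sum G T)"

definition generators :: "('a, 'b) monoid_scheme \<Rightarrow> 'a set" where
  "generators G = {h \<in> carrier G. generate G {h} = carrier G}"

(* The coefficient k in [1, |G|] with a = k h; unique when h generates the finite group G. *)
definition coefficient :: "('a, 'b) monoid_scheme \<Rightarrow> 'a \<Rightarrow> 'a \<Rightarrow> nat" where
  "coefficient G h a = (THE k. k \<in> {1..order G} \<and> h [^]\<^bsub>G\<^esub> k = a)"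

definition seq_norm :: "('a, 'b) monoid_scheme \<Rightarrow> 'a \<Rightarrow> 'a multiset \<Rightarrow> real" where
  "seq_norm G h S = real (\<Sum>a\<in>#S. coefficient G h a) / real (group.ord G h)"

(* Meant for finite cyclic G, where the set below is finite and nonempty. *)
definition seq_index :: "('a, 'b) monoid_scheme \<Rightarrow> 'a multiset \<Rightarrow> real" where
  "seq_index G S = Min ((\<lambda>h. seq_norm G h S) ` generators G)"

lemma (in comm_group) seq_sum_empty: "seq_sum G {#} = \<one>"
  by (simp add: seq_sum_def)

lemma (in comm_group) seq_sum_add_mset:
  assumes "a \<in> carrier G" "set_mset S \<subseteq> carrier G"
  shows "seq_sum G (add_mset a S) = a \<otimes> seq_sum G S"
proof -
  let ?f = "\<lambda>S b. b [^] count S b"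
  let ?R = "set_mset S - {a}"
  have cl: "?f T \<in> ?R \<rightarrow> carrier G" for T using assms by auto
  have R: "finprod G (?f (add_mset a S)) ?R = finprod G (?f S) ?R"
    using assms by (intro finprod_cong') auto
  have ins: "finprod G (?f T) (insert a ?R) = ?f T a \<otimes> finprod G (?f T) ?R" for T
    using assms by (intro finprod_insert) auto
  have S: "seq_sum G S = ?f S a \<otimes> finprod G (?f S) ?R"
  proof (cases "a \<in># S")
    case True
    then show ?thesis using ins[of S] by (simp add: seq_sum_def insert_absorb)
  next
    case False
    then show ?thesis
      using finprod_closed[OF cl] by (simp add: seq_sum_def not_in_iff)
  qed
  have "seq_sum G (add_mset a S) = ?f (add_mset a S) a \<otimes> finprod G (?f (add_mset a S)) ?R"
    using ins[of "add_mset a S"] by (simp add: seq_sum_def)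
  also have "\<dots> = (a \<otimes> ?f S a) \<otimes> finprod G (?f S) ?R"
    using assms R nat_pow_Suc2[of a "count S a"] by simp
  also have "\<dots> = a \<otimes> seq_sum G S"
    using assms S finprod_closed[OF cl] by (simp add: m_assoc)
  finally show ?thesis .
qed

lemma (in group) coefficient_eqI:
  assumes "finite (carrier G)" "h \<in> generators G" "k \<in> {1..order G}" "h [^] k = a"
  shows "coefficient G h a = k"
proof -
  have h: "h \<in> carrier G" and "generate G {h} = carrier G"
    using assms(2) by (auto simp: generators_def)
  then have o: "ord h = order G"
    using generate_pow_card[OF h] by (simp add: order_def)
  have "inj_on (\<lambda>k. h [^] k) {1..ord h}"
    using ord_inj'[OF h] by simp
  then show ?thesis
    unfolding coefficient_def using assms(3,4) o
    by (intro the_equality) (auto dest: inj_onD)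
qed

end

theory Submission
  imports Defs "HOL-Number_Theory.Cong"
begin

text \<open>
  Multiplying by a unit \<open>u\<close> modulo \<open>n\<close> corresponds to a change of generator, and replacing \<open>u\<close> by
  \<open>-u\<close> exchanges the residue sums \<open>n\<close> and \<open>3 n\<close>; so the index is 1 unless the residues of
  \<open>u x\<^sub>1, \<dots>, u x\<^sub>4\<close> add up to \<open>2 n\<close> for every unit \<open>u\<close>. In that case let \<open>p\<close> be a prime dividing
  \<open>n\<close> and \<open>x\<^sub>1\<close>, and average over the units congruent to 1 modulo \<open>n / p\<close>. If \<open>p\<close> divides a second
  \<open>x\<^sub>i\<close>, the average forces \<open>u (x\<^sub>1 + x\<^sub>i)\<close> to be near \<open>0\<close> modulo \<open>n\<close> for all \<open>u\<close>, which fails for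
  some \<open>u\<close>. Otherwise it forces \<open>u x\<^sub>1\<close> to be near \<open>n / 2\<close>; taking \<open>u x\<^sub>1 = gcd(x\<^sub>1, n)\<close>, this leaves
  only \<open>p = 5\<close> or \<open>p = 7\<close> with \<open>p\<^sup>2\<close> not dividing \<open>n\<close>, and then only \<open>gcd(x\<^sub>1, n) = 5\<close>. Here the
  four units over each unit modulo \<open>N = n / 5\<close> are used individually: they determine the other three
  terms modulo \<open>N\<close>, and comparing the multipliers 1, 2 and 3 gives a contradiction.
\<close>

section \<open>Averaging over units\<close>

text \<open>The case to be excluded. Integers admit negative multipliers, and letting
  \<open>u\<close> range over all integers prime to \<open>n\<close> spares reducing products of
  units.\<close>

definition balanced :: "int \<Rightarrow> int \<Rightarrow> int \<Rightarrow> int \<Rightarrow> int \<Rightarrow> bool" where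
  "balanced n x1 x2 x3 x4 \<longleftrightarrow>
     (\<forall>u. coprime u n \<longrightarrow> u * x1 mod n + u * x2 mod n + u * x3 mod n + u * x4 mod n = 2 * n)"

lemma balancedD:
  "balanced n x1 x2 x3 x4 \<Longrightarrow> coprime u n \<Longrightarrow>
     u * x1 mod n + u * x2 mod n + u * x3 mod n + u * x4 mod n = 2 * n"
  by (simp add: balanced_def)

lemma balanced_mult:
  assumes "balanced n x1 x2 x3 x4" "coprime v n"
  shows "balanced n (v * x1) (v * x2) (v * x3) (v * x4)"
  unfolding balanced_def
proof (intro allI impI)
  fix u assume "coprime u n"
  then have "coprime (u * v) n" using assms(2) by simp
  from balancedD[OF assms(1) this]
  show "u * (v * x1) mod n + u * (v * x2) mod n + u * (v * x3) mod n + u * (v * x4) mod n = 2 * n"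
    by (simp add: mult.assoc)
qed

lemma balanced_dvd_sum:
  assumes "balanced n x1 x2 x3 x4"
  shows "n dvd x1 + x2 + x3 + x4"
proof -
  have "x1 mod n + x2 mod n + x3 mod n + x4 mod n = 2 * n"
    using balancedD[OF assms, of 1] by simp
  then have "x1 + x2 + x3 + x4 = n * (2 + x1 div n + x2 div n + x3 div n + x4 div n)"
    using mult_div_mod_eq[of n x1] mult_div_mod_eq[of n x2] mult_div_mod_eq[of n x3]
      mult_div_mod_eq[of n x4]
    by (simp only: distrib_left)
  then show ?thesis by simp
qed

section \<open>Units with prescribed residues\<close>

text \<open>Take for \<open>t\<close> the product of the primes dividing \<open>n\<close> but not
  \<open>v\<close>. Each prime divisor of \<open>n\<close> then divides exactly one of
  \<open>v\<close> and \<open>m * t\<close>, hence not their sum.\<close>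

lemma coprime_lift:
  fixes v m n :: int
  assumes "coprime v m" "n \<noteq> 0"
  shows "\<exists>t. coprime (v + m * t) n"
proof -
  define P where "P = {p \<in> prime_factors n. \<not> p dvd v}"
  have fin: "finite P" by (simp add: P_def)
  have "coprime (v + m * \<Prod>P) n"
  proof (rule ccontr)
    assume "\<not> coprime (v + m * \<Prod>P) n"
    then have "gcd (v + m * \<Prod>P) n \<noteq> 1" by (simp add: coprime_iff_gcd_eq_1)
    then have "\<not> is_unit (gcd (v + m * \<Prod>P) n)" by simp
    moreover have "gcd (v + m * \<Prod>P) n \<noteq> 0" using assms(2) by simp
    ultimately obtain p where p: "Factorial_Ring.prime p" "p dvd gcd (v + m * \<Prod>P) n"
      using prime_divisor_exists by blast
    then have pn: "p \<in> prime_factors n" and ps: "p dvd v + m * \<Prod>P"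
      using assms(2) by (auto simp: prime_factors_dvd)
    show False
    proof (cases "p dvd v")
      case True
      then have "p dvd m * \<Prod>P" using ps by (simp add: dvd_add_right_iff)
      moreover have "\<not> p dvd m"
        using True assms(1) p(1) by (meson coprime_common_divisor not_prime_unit)
      ultimately have "p dvd \<Prod>P" using p(1) by (simp add: prime_dvd_mult_iff)
      then obtain q where q: "q \<in> P" "p dvd q"
        using prime_dvd_prod_iff[OF fin p(1), of "\<lambda>x. x"] by auto
      then have "p = q" using p(1) by (auto simp: P_def intro: primes_dvd_imp_eq)
      then show False using q True by (simp add: P_def)
    next
      case False
      then have "p \<in> P" using pn by (simp add: P_def)
      then have "p dvd m * \<Prod>P" using dvd_prodI[OF fin, of p "\<lambda>x. x"] by simp
      then show False using ps False by (simp add: dvd_add_left_iff)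
    qed
  qed
  then show ?thesis by blast
qed

text \<open>The cofactor \<open>x div gcd x n\<close> is invertible modulo
  \<open>n div gcd x n\<close>; its inverse times \<open>c\<close> lifts to a unit modulo
  \<open>n\<close>. So a unit can move \<open>x\<close> to any residue having the same gcd with
  \<open>n\<close>.\<close>

lemma unit_multiple:
  fixes n x c :: int
  assumes "n \<noteq> 0" "coprime c (n div gcd x n)"
  shows "\<exists>u. coprime u n \<and> [u * x = c * gcd x n] (mod n)"
proof -
  let ?g = "gcd x n"
  define m y where "m = n div ?g" and "y = x div ?g"
  have g: "?g \<noteq> 0" using assms(1) by simp
  have n: "n = ?g * m" and x: "x = ?g * y" by (simp_all add: m_def y_def)
  have "coprime y m" unfolding y_def m_def using assms(1) by (intro div_gcd_coprime) auto
  then obtain w where w: "[y * w = 1] (mod m)" using cong_solve_coprime_int by blast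
  then have "coprime w m"
    by (metis coprime_iff_invertible_int mult.commute)
  then have "coprime (c * w) m" using assms(2) by (simp add: m_def)
  then obtain t where t: "coprime (c * w + m * t) n" using coprime_lift[OF _ assms(1)] by blast
  have "[(c * w + m * t) * y = c] (mod m)"
  proof -
    have "[(c * w + m * t) * y = c * (y * w)] (mod m)"
      by (simp add: cong_iff_dvd_diff algebra_simps)
    also have "[c * (y * w) = c * 1] (mod m)" using w by (rule cong_scalar_left)
    finally show ?thesis by simp
  qed
  then have "m dvd (c * w + m * t) * y - c" by (simp add: cong_iff_dvd_diff)
  then have "?g * m dvd ?g * ((c * w + m * t) * y - c)" by (rule mult_dvd_mono[OF dvd_refl])
  then have "n dvd (c * w + m * t) * x - c * ?g"
    using n x by (metis (no_types, lifting) mult.commute mult.left_commute right_diff_distrib')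
  then show ?thesis using t by (auto simp: cong_iff_dvd_diff)
qed

section \<open>Sums over the multipliers \<open>1 + k * N\<close>\<close>

lemma coprime_one_plus_mult:
  fixes N k :: int
  shows "coprime (1 + k * N) N"
  by (rule coprimeI) (metis dvd_add_left_iff dvd_mult)

text \<open>Split a residue modulo \<open>p * N\<close> into \<open>N\<close> times a leading digit
  plus a remainder below \<open>N\<close>. Adding \<open>k * N * x\<close> moves only the digit, by
  \<open>k * x\<close> modulo \<open>p\<close>.\<close>

lemma shift_mod:
  fixes p N x k :: int
  assumes "p > 0" "N > 0"
  shows "(1 + k * N) * x mod (p * N) = N * ((x div N + k * x) mod p) + x mod N"
proof -
  have "(1 + k * N) * x = N * (x div N + k * x) + x mod N"
    by (simp add: algebra_simps)
  moreover have "(N * (x div N + k * x) + x mod N) div N = x div N + k * x"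
    using assms by simp
  moreover have "(N * (x div N + k * x) + x mod N) mod N = x mod N" by simp
  ultimately have "(1 + k * N) * x div N = x div N + k * x" "(1 + k * N) * x mod N = x mod N"
    by presburger+
  then show ?thesis
    using mod_mult2_eq'[of "(1 + k * N) * x" "nat N" "nat p"] assms
    by (simp add: mult.commute)
qed

lemma shift_mod_dvd:
  fixes p N x k :: int
  assumes "p dvd x"
  shows "(1 + k * N) * x mod (p * N) = x mod (p * N)"
proof -
  obtain y where "x = p * y" using assms by blast
  then have "(1 + k * N) * x = x + (p * N) * (k * y)" by (simp add: algebra_simps)
  then show ?thesis by simp
qed

lemma sum_atLeast0LessThan_int: "0 \<le> p \<Longrightarrow> 2 * (\<Sum>k\<in>{0..<p}. k) = p * (p - 1 :: int)"
proof (induction p rule: int_ge_induct)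
  case base
  show ?case by simp
next
  case (step p)
  have "{0..<p + 1} = insert p {0..<p}" using step(1) by auto
  then show ?case using step by (simp add: algebra_simps)
qed

text \<open>
  For \<open>n = p * N\<close> the multipliers \<open>1 + k * N\<close> fix the multiples of \<open>p\<close> modulo \<open>n\<close> and spread every
  other residue evenly over a progression of step \<open>N\<close>. They are all units if \<open>p dvd N\<close>; otherwise
  exactly one of them is not, namely the one congruent to \<open>p * e\<close>, where \<open>e\<close> inverts \<open>p\<close> modulo \<open>N\<close>.
\<close>

definition shift_sum :: "int \<Rightarrow> int \<Rightarrow> int \<Rightarrow> int" where
  "shift_sum p N x = (\<Sum>k\<in>{0..<p}. (1 + k * N) * x mod (p * N))"

lemma shift_sum_dvd: "0 \<le> p \<Longrightarrow> p dvd x \<Longrightarrow> shift_sum p N x = p * (x mod (p * N))"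
  by (simp add: shift_sum_def shift_mod_dvd)

text \<open>As \<open>x\<close> is invertible modulo \<open>p\<close>, the leading digits run once
  through all residues modulo \<open>p\<close>. Doubling avoids dividing \<open>p * (p - 1)\<close>
  by 2.\<close>

lemma shift_sum_not_dvd:
  fixes p N x :: int
  assumes "Factorial_Ring.prime p" "N > 0" "\<not> p dvd x"
  shows "2 * shift_sum p N x = 2 * p * (x mod N) + N * (p * (p - 1))"
proof -
  have p: "p > 0" using assms(1) prime_gt_0_int by blast
  let ?f = "\<lambda>k. (x div N + k * x) mod p"
  have inj: "inj_on ?f {0..<p}"
  proof (rule inj_onI)
    fix a b assume ab: "a \<in> {0..<p}" "b \<in> {0..<p}" "?f a = ?f b"
    then have "p dvd (x div N + a * x) - (x div N + b * x)" by (simp add: mod_eq_dvd_iff)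
    then have "p dvd (a - b) * x" by (simp add: algebra_simps)
    then have "p dvd a - b" using assms by (simp add: prime_dvd_mult_iff)
    then have "a mod p = b mod p" by (simp add: mod_eq_dvd_iff)
    then show "a = b" using ab by simp
  qed
  have "?f ` {0..<p} = {0..<p}"
    by (rule endo_inj_surj) (use p inj in auto)
  then have "(\<Sum>k\<in>{0..<p}. ?f k) = (\<Sum>k\<in>{0..<p}. k)"
    using sum.reindex[OF inj, of "\<lambda>k. k"] by simp
  then have "2 * (\<Sum>k\<in>{0..<p}. ?f k) = p * (p - 1)"
    using sum_atLeast0LessThan_int[of p] p by simp
  moreover have "shift_sum p N x = N * (\<Sum>k\<in>{0..<p}. ?f k) + p * (x mod N)"
    using p assms(2) by (simp add: shift_sum_def shift_mod sum.distrib sum_distrib_left)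
  ultimately show ?thesis by (simp only: distrib_left mult.left_commute mult.assoc)
qed

lemma balanced_sum_shift_dvd:
  fixes p N :: int
  assumes "balanced (p * N) x1 x2 x3 x4" "Factorial_Ring.prime p" "N > 0" "p dvd N"
  shows "shift_sum p N x1 + shift_sum p N x2 + shift_sum p N x3 + shift_sum p N x4 = 2 * (p * N) * p"
proof -
  have p: "p > 0" using assms(2) prime_gt_0_int by blast
  have "coprime (1 + k * N) (p * N)" for k
  proof -
    have "coprime (1 + k * N) N" by (rule coprime_one_plus_mult)
    moreover have "coprime (1 + k * N) p"
      using calculation assms(4) by (meson coprime_divisors dvd_refl)
    ultimately show ?thesis by simp
  qed
  then have "(1 + k * N) * x1 mod (p * N) + (1 + k * N) * x2 mod (p * N)
      + (1 + k * N) * x3 mod (p * N) + (1 + k * N) * x4 mod (p * N) = 2 * (p * N)" for k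
    using balancedD[OF assms(1)] by blast
  then have "shift_sum p N x1 + shift_sum p N x2 + shift_sum p N x3 + shift_sum p N x4
      = (\<Sum>k\<in>{0..<p}. 2 * (p * N))"
    unfolding shift_sum_def sum.distrib[symmetric] by (intro sum.cong) auto
  then show ?thesis using p by simp
qed

text \<open>\<open>F\<close> drops from \<open>shift_sum\<close> the one nonunit multiplier, whose
  residue at \<open>x\<close> is \<open>p * (e * x mod N)\<close>; the other \<open>p - 1\<close>
  multipliers are units.\<close>

lemma balanced_sum_shift_coprime:
  fixes p N e :: int
  assumes "balanced (p * N) x1 x2 x3 x4" "Factorial_Ring.prime p" "N > 0" "\<not> p dvd N" "[p * e = 1] (mod N)"
  defines "F \<equiv> \<lambda>x. shift_sum p N x - p * (e * x mod N)"
  shows "F x1 + F x2 + F x3 + F x4 = 2 * (p * N) * (p - 1)"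
proof -
  have p: "p > 0" using assms(2) prime_gt_0_int by blast
  obtain c where c: "p * e = 1 + N * c"
    using assms(5) by (metis cong_iff_lin cong_sym)
  define k0 where "k0 = c mod p"
  have k0: "k0 \<in> {0..<p}" using p by (simp add: k0_def)
  have k0_dvd: "p dvd 1 + k0 * N"
  proof -
    have "1 + k0 * N = p * e - N * (c - c mod p)"
      unfolding c k0_def by (simp add: algebra_simps)
    moreover have "p dvd c - c mod p" by simp
    ultimately show ?thesis by simp
  qed
  have ex: "(1 + k0 * N) * x mod (p * N) = p * (e * x mod N)" for x
  proof -
    have "N * (c mod p) + N * (p * (c div p)) = N * c" by (simp flip: distrib_left)
    then have eq: "1 + k0 * N = p * e - p * N * (c div p)"
      unfolding c k0_def by (simp add: algebra_simps)
    have "(1 + k0 * N) * x = p * (e * x) + (p * N) * (- (c div p) * x)"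
      unfolding eq by (simp add: algebra_simps)
    then have "(1 + k0 * N) * x mod (p * N) = p * (e * x) mod (p * N)" by (simp only: mod_mult_self2)
    then show ?thesis by (simp only: mult_mod_right)
  qed
  have F: "F x = (\<Sum>k\<in>{0..<p} - {k0}. (1 + k * N) * x mod (p * N))" for x
    unfolding F_def shift_sum_def using k0 ex[of x] by (subst sum.remove[of _ k0]) auto
  have "coprime (1 + k * N) (p * N)" if k: "k \<in> {0..<p} - {k0}" for k
  proof -
    have "coprime (1 + k * N) N" by (rule coprime_one_plus_mult)
    moreover have "\<not> p dvd 1 + k * N"
    proof
      assume "p dvd 1 + k * N"
      then have "p dvd (1 + k * N) - (1 + k0 * N)" using k0_dvd by (rule dvd_diff)
      then have "p dvd (k - k0) * N" by (simp add: algebra_simps)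
      then have "p dvd k - k0" using assms by (simp add: prime_dvd_mult_iff)
      then have "k mod p = k0 mod p" by (simp add: mod_eq_dvd_iff)
      then show False using k k0 by simp
    qed
    ultimately show ?thesis using assms(2) by (simp add: coprime_commute prime_imp_coprime)
  qed
  then have "(1 + k * N) * x1 mod (p * N) + (1 + k * N) * x2 mod (p * N)
      + (1 + k * N) * x3 mod (p * N) + (1 + k * N) * x4 mod (p * N) = 2 * (p * N)"
    if "k \<in> {0..<p} - {k0}" for k
    using balancedD[OF assms(1)] that by blast
  then have "F x1 + F x2 + F x3 + F x4 = (\<Sum>k\<in>{0..<p} - {k0}. 2 * (p * N))"
    unfolding F sum.distrib[symmetric] by (intro sum.cong) auto
  then show ?thesis using p k0 by (simp add: algebra_simps)
qed

section \<open>Primes dividing one or two terms of a balanced quadruple\<close>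

lemma factor_ge_5:
  fixes n d :: int
  assumes "coprime n 6" "d dvd n" "d > 1"
  shows "d \<ge> 5"
proof (rule ccontr)
  assume "\<not> d \<ge> 5"
  then have "d = 2 \<or> d = 3 \<or> d = 4" using assms(3) by linarith
  then have "2 dvd d \<or> 3 dvd d" by auto
  then have "2 dvd n \<or> 3 dvd n" using assms(2) dvd_trans by blast
  then show False
    using assms(1) coprime_common_divisor[of n 6 2] coprime_common_divisor[of n 6 3] by auto
qed

lemma dvd_sum_mod_iff:
  fixes N :: int
  shows "N dvd a mod N + b mod N + c mod N + d \<longleftrightarrow> N dvd a + b + c + d"
proof -
  have "a + b + c + d = (a mod N + b mod N + c mod N + d) + N * (a div N + b div N + c div N)"
    unfolding minus_mult_div_eq_mod[symmetric] by (simp add: algebra_simps)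
  then show ?thesis by (metis dvd_add_left_iff dvd_triv_left)
qed

text \<open>The nonunit multiplier, congruent to \<open>p * e\<close>, also fixes multiples of
  \<open>p\<close>; such a \<open>y\<close> therefore enters the sum over units as
  \<open>p - 1\<close> times its residue.\<close>

lemma mult_inverse_mod_dvd:
  fixes p N e y :: int
  assumes "[p * e = 1] (mod N)" "p dvd y"
  shows "p * (e * y mod N) = y mod (p * N)"
proof -
  obtain z where z: "y = p * z" using assms(2) by blast
  have "[p * e * z = 1 * z] (mod N)" using assms(1) by (rule cong_scalar_right)
  then have "e * y mod N = z mod N" unfolding cong_def z by (simp add: ac_simps)
  then have "p * (e * y mod N) = p * (z mod N)" by simp
  also have "\<dots> = y mod (p * N)" unfolding z by (rule mult_mod_right)
  finally show ?thesis .
qed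

text \<open>Averaging relates the sum \<open>R\<close> of the first two residues to the sum
  \<open>a\<close> of the other two modulo \<open>N\<close>: \<open>R + a = n + N\<close> if
  \<open>p\<close> divides \<open>N\<close>, and a similar relation in \<open>a - b\<close>
  otherwise. Since \<open>a\<close> and \<open>b\<close> lie between 0 and \<open>2 * N\<close>,
  this excludes both values of \<open>R\<close> available after rescaling.\<close>

lemma balanced_two_dvd:
  fixes n p :: int
  assumes bal: "balanced n x1 x2 x3 x4" and n: "n > 0" "coprime n 6"
    and p: "Factorial_Ring.prime p" "p dvd n"
    and dvd: "p dvd x1" "p dvd x2" "\<not> p dvd x3" "\<not> p dvd x4"
    and sum: "\<not> n dvd x1 + x2"
  shows False
proof -
  define s m N where "s = gcd (x1 + x2) n" and "m = n div s" and "N = n div p"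
  have p5: "p \<ge> 5" using factor_ge_5[OF n(2) p(2)] prime_gt_1_int[OF p(1)] by simp
  have nN: "n = p * N" using p(2) by (simp add: N_def)
  have N: "N > 0" using nN n(1) p5 by (simp add: zero_less_mult_iff)
  have s: "s > 0" using n(1) by (simp add: s_def)
  have nm: "n = s * m" by (simp add: s_def m_def)
  have "m > 0" using nm n(1) s by (simp add: zero_less_mult_iff)
  moreover have "m \<noteq> 1" using nm sum by (metis s_def gcd_dvd1 mult.right_neutral)
  ultimately have m: "m \<ge> 5" using factor_ge_5[OF n(2), of m] nm by auto
  have "odd m"
    using n(2) nm coprime_common_divisor[of n 6 2] by auto
  then obtain h where h: "m = 2 * h + 1" by (elim oddE)
  \<comment> \<open>Rescale so that \<open>x1 + x2\<close> lies next to \<open>n / 2\<close>, as far as possible from the value \<open>n\<close> that averaging suggests.\<close>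
  have "coprime h m"
    unfolding h using coprime_one_plus_mult[of 2 h] by (simp add: ac_simps)
  then obtain u where u: "coprime u n" "[u * (x1 + x2) = h * s] (mod n)"
    using unit_multiple[of n h "x1 + x2"] n(1) by (auto simp: m_def s_def)
  define y1 y2 y3 y4 where y: "y1 = u * x1" "y2 = u * x2" "y3 = u * x3" "y4 = u * x4"
  have baly: "balanced (p * N) y1 y2 y3 y4"
    unfolding y nN[symmetric] by (rule balanced_mult[OF bal u(1)])
  have "\<not> p dvd u" using u(1) p by (meson coprime_common_divisor not_prime_unit)
  then have dvdy: "p dvd y1" "p dvd y2" "\<not> p dvd y3" "\<not> p dvd y4"
    using dvd p(1) by (simp_all add: y prime_dvd_mult_iff)
  have hs: "2 * (h * s) = n - s" by (simp add: nm h algebra_simps)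
  have s5: "5 * s \<le> n" using mult_right_mono[OF m, of s] s nm by (simp add: mult.commute)
  have N5: "5 * N \<le> n" using mult_right_mono[OF p5, of N] N nN by simp
  define R where "R = y1 mod (p * N) + y2 mod (p * N)"
  have "R mod n = h * s mod n"
    using u(2) by (simp add: R_def y nN[symmetric] mod_simps cong_def distrib_left)
  also have "\<dots> = h * s" using hs s s5 by (intro mod_pos_pos_trivial) auto
  finally have Rmod: "R mod n = h * s" .
  have "0 \<le> R" "R < 2 * n"
    using n(1) pos_mod_bound[of n y1] pos_mod_bound[of n y2] pos_mod_sign[of n y1] pos_mod_sign[of n y2]
    unfolding R_def nN[symmetric] by linarith+
  then have "R = R mod n \<or> R - n = R mod n"
    using mod_pos_pos_trivial[of R n] mod_pos_pos_trivial[of "R - n" n]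
    by (cases "R < n") simp_all
  then have R: "R = h * s \<or> R = n + h * s" using Rmod by auto
  note sh = shift_sum_not_dvd[OF p(1) N dvdy(3)] shift_sum_not_dvd[OF p(1) N dvdy(4)]
  define a where "a = y3 mod N + y4 mod N"
  have a: "0 \<le> a" "a < 2 * N"
    using N pos_mod_bound[of N y3] pos_mod_bound[of N y4] pos_mod_sign[of N y3] pos_mod_sign[of N y4]
    unfolding a_def by linarith+
  have p0: "p > 0" using p5 by simp
  then have sd: "shift_sum p N y1 = p * (y1 mod (p * N))" "shift_sum p N y2 = p * (y2 mod (p * N))"
    using dvdy by (simp_all add: shift_sum_dvd)
  show False
  proof (cases "p dvd N")
    case True
    note H = balanced_sum_shift_dvd[OF baly p(1) N True]
    have "2 * p * (R + a) + 2 * (N * (p * (p - 1))) = 2 * (2 * (p * N) * p)"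
      using H sh sd by (simp add: R_def a_def algebra_simps)
    then have "p * (R + a) = p * (n + N)" by (simp add: nN algebra_simps)
    then have "R + a = n + N" using p0 by simp
    then show False using R hs s5 N5 a s N by (elim disjE) linarith+
  next
    case False
    then have "coprime p N" using p(1) by (simp add: prime_imp_coprime)
    then obtain e where e: "[p * e = 1] (mod N)" using cong_solve_coprime_int by blast
    define b where "b = e * y3 mod N + e * y4 mod N"
    have b: "0 \<le> b" "b < 2 * N"
      using N pos_mod_bound[of N "e * y3"] pos_mod_bound[of N "e * y4"]
        pos_mod_sign[of N "e * y3"] pos_mod_sign[of N "e * y4"]
      unfolding b_def by linarith+
    note H = balanced_sum_shift_coprime[OF baly p(1) N False e]
    have e12: "p * (e * y1 mod N) = y1 mod (p * N)" "p * (e * y2 mod N) = y2 mod (p * N)"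
      using mult_inverse_mod_dvd[OF e] dvdy by auto
    have "2 * (p - 1) * R + 2 * p * (a - b) + 2 * (N * (p * (p - 1))) = 2 * (2 * (p * N) * (p - 1))"
      using H sh sd e12 by (simp add: R_def a_def b_def algebra_simps)
    then have main: "(p - 1) * R + p * (a - b) = p * (N * (p - 1))" by (simp add: algebra_simps)
    have "p dvd s" using dvd p(2) by (simp add: s_def)
    then obtain s' where s': "s = p * s'" by blast
    have s'0: "s' > 0" using s p0 by (simp add: s' zero_less_mult_iff)
    define T where "T = s' * h"
    have Ns: "N = s' * m" using nm nN s' p0 by simp
    then have T: "2 * T = N - s'" by (simp add: T_def h algebra_simps)
    have s'5: "5 * s' \<le> N" using mult_right_mono[OF m, of s'] s'0 Ns by (simp add: mult.commute)
    have hsT: "h * s = p * T" by (simp add: s' T_def)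
    \<comment> \<open>Modulo \<open>N\<close> the four terms sum to 0 and \<open>y1 + y2\<close> is
      \<open>p * T\<close>; multiplying by \<open>e\<close> makes \<open>e * (y3 + y4)\<close> equal
      to \<open>- T\<close>. This pins \<open>b\<close> to two values.\<close>
    have "N dvd b + T"
    proof -
      have 1: "N dvd y1 + y2 + y3 + y4" using balanced_dvd_sum[OF baly] dvd_mult_right by blast
      have 2: "N dvd y1 + y2 - p * T"
        using u(2) hsT nN by (simp add: y cong_iff_dvd_diff distrib_left) (meson dvd_mult_right)
      have 3: "N dvd p * e - 1" using e by (simp add: cong_iff_dvd_diff)
      have "e * y3 + e * y4 + T = e * (y1 + y2 + y3 + y4) - e * (y1 + y2 - p * T) - (p * e - 1) * T"
        by (simp add: algebra_simps)
      then have "N dvd e * y3 + e * y4 + T" using 1 2 3 by simp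
      then show ?thesis using dvd_sum_mod_iff[of N "e * y3" "e * y4" 0 T] by (simp add: b_def)
    qed
    then obtain c where c: "b + T = N * c" by blast
    have "0 < N * c" "N * c < N * 3" using c b T s'0 s'5 by linarith+
    then have "0 < c" "c < 3" using N by (simp_all add: zero_less_mult_iff)
    then have "c = 1 \<or> c = 2" by linarith
    then have b': "b = N - T \<or> b = 2 * N - T" using c by auto
    from R show False
    proof
      assume "R = h * s"
      then have "p * ((p - 1) * (N - T)) = p * (a - b)"
        using main by (simp add: hsT algebra_simps)
      then have eq: "(p - 1) * (N - T) = a - b" using p0 by simp
      have "4 * (N - T) \<le> (p - 1) * (N - T)" using p5 T s'0 s'5 by (intro mult_right_mono) auto
      then have "4 * (N - T) \<le> a - b" by (simp only: eq)
      moreover have "N - T \<le> b" using b' N by auto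
      ultimately show False using a T s'0 N by (smt (verit))
    next
      assume "R = n + h * s"
      then have "p * (p * T) = p * (b - a + T)"
        using main by (simp add: hsT nN algebra_simps)
      then have eq: "p * T = b - a + T" using p0 by simp
      have b2: "b \<le> 2 * N - T" using b' N by auto
      show False
      \<comment> \<open>Now \<open>p * T\<close> is at most \<open>2 * N\<close>, while
        \<open>T\<close> is at least \<open>2 * N / 5\<close>. For \<open>p = 5\<close> equality
        survives, but it would give \<open>N = 5 * s'\<close>, against \<open>p\<close> not dividing
        \<open>N\<close>.\<close>
      proof (cases "p = 5")
        case True
        then have "5 * T = b - a + T" using eq by simp
        then have "N = 5 * s'" using a b2 T s'5 by (smt (verit))
        then show False using False \<open>\<not> p dvd N\<close> True by simp
      next
        case False
        then have "6 * T \<le> p * T" using p5 T s'0 s'5 by (intro mult_right_mono) auto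
        then have "6 * T \<le> b - a + T" by (simp only: eq)
        then show False using a b2 T s'0 s'5 by (smt (verit))
      qed
    qed
  qed
qed

text \<open>Scale \<open>x1\<close> to \<open>d = gcd x1 n\<close>, which is at most
  \<open>n / 5\<close>. If \<open>p\<close> divides \<open>n div p\<close>, the average needs a
  larger \<open>d\<close>; otherwise \<open>a \<le> 3 * N - 3\<close> and
  \<open>b \<ge> N - d / p\<close> turn it into the inequality.\<close>

lemma balanced_one_dvd:
  fixes n p :: int
  assumes bal: "balanced n x1 x2 x3 x4" and n: "n > 0" "coprime n 6"
    and p: "Factorial_Ring.prime p" "p dvd n"
    and dvd: "p dvd x1" "\<not> p dvd x2" "\<not> p dvd x3" "\<not> p dvd x4"
    and nx1: "\<not> n dvd x1"
  shows "\<not> p dvd n div p" "(p - 5) * n + 6 * p \<le> 2 * p * gcd x1 n"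
proof -
  define d m N where "d = gcd x1 n" and "m = n div d" and "N = n div p"
  have p5: "p \<ge> 5" using factor_ge_5[OF n(2) p(2)] prime_gt_1_int[OF p(1)] by simp
  have nN: "n = p * N" using p(2) by (simp add: N_def)
  have N: "N > 0" using nN n(1) p5 by (simp add: zero_less_mult_iff)
  have d: "d > 0" using n(1) by (simp add: d_def)
  have nm: "n = d * m" by (simp add: d_def m_def)
  have "m > 0" using nm n(1) d by (simp add: zero_less_mult_iff)
  moreover have "m \<noteq> 1" using nm nx1 by (metis d_def gcd_dvd1 mult.right_neutral)
  ultimately have m: "m \<ge> 5" using factor_ge_5[OF n(2), of m] nm by auto
  obtain u where u: "coprime u n" "[u * x1 = d] (mod n)"
    using unit_multiple[of n 1 x1] n(1) by (auto simp: m_def d_def)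
  define y1 y2 y3 y4 where y: "y1 = u * x1" "y2 = u * x2" "y3 = u * x3" "y4 = u * x4"
  have baly: "balanced (p * N) y1 y2 y3 y4"
    unfolding y nN[symmetric] by (rule balanced_mult[OF bal u(1)])
  have "\<not> p dvd u" using u(1) p by (meson coprime_common_divisor not_prime_unit)
  then have dvdy: "p dvd y1" "\<not> p dvd y2" "\<not> p dvd y3" "\<not> p dvd y4"
    using dvd p(1) by (simp_all add: y prime_dvd_mult_iff)
  have d5: "5 * d \<le> n" using mult_right_mono[OF m, of d] d nm by (simp add: mult.commute)
  have N5: "5 * N \<le> n" using mult_right_mono[OF p5, of N] N nN by simp
  have "y1 mod n = d mod n" using u(2) by (simp add: y cong_def)
  also have "\<dots> = d" using d d5 by (intro mod_pos_pos_trivial) auto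
  finally have R: "y1 mod (p * N) = d" by (simp add: nN)
  note sh = shift_sum_not_dvd[OF p(1) N dvdy(2)] shift_sum_not_dvd[OF p(1) N dvdy(3)]
    shift_sum_not_dvd[OF p(1) N dvdy(4)]
  define a where "a = y2 mod N + y3 mod N + y4 mod N"
  \<comment> \<open>The slack of 1 in each residue becomes the term \<open>6 * p\<close>, which
    later rules out the gcd 7 for \<open>n = 35\<close>.\<close>
  have "y2 mod N < N" "y3 mod N < N" "y4 mod N < N" using N by auto
  then have a: "a \<le> 3 * N - 3" unfolding a_def by linarith
  have p0: "p > 0" using p5 by simp
  then have sd: "shift_sum p N y1 = p * (y1 mod (p * N))"
    using dvdy by (simp add: shift_sum_dvd)
  show ndvd: "\<not> p dvd n div p"
  proof
    assume "p dvd n div p"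
    then have True: "p dvd N" by (simp add: N_def)
    note H = balanced_sum_shift_dvd[OF baly p(1) N True]
    have "2 * p * (d + a) + 3 * (N * (p * (p - 1))) = 2 * (2 * (p * N) * p)"
      using H sh sd R by (simp add: a_def algebra_simps)
    then have "p * (2 * (d + a)) = p * (n + 3 * N)" by (simp add: nN algebra_simps)
    then have "2 * (d + a) = n + 3 * N" using p0 by simp
    then show False using d5 N5 a N by (smt (verit))
  qed
  have False: "\<not> p dvd N" using ndvd by (simp add: N_def)
  then have "coprime p N" using p(1) by (simp add: prime_imp_coprime)
  then obtain e where e: "[p * e = 1] (mod N)" using cong_solve_coprime_int by blast
  define b where "b = e * y2 mod N + e * y3 mod N + e * y4 mod N"
  have "0 \<le> e * y2 mod N" "0 \<le> e * y3 mod N" "0 \<le> e * y4 mod N" using N by auto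
  then have b: "0 \<le> b" unfolding b_def by linarith
  note H = balanced_sum_shift_coprime[OF baly p(1) N False e]
  have e1: "p * (e * y1 mod N) = y1 mod (p * N)"
    using mult_inverse_mod_dvd[OF e] dvdy by auto
  have "2 * (p - 1) * d + 2 * p * (a - b) + 3 * (N * (p * (p - 1))) = 2 * (2 * (p * N) * (p - 1))"
    using H sh sd e1 R by (simp add: a_def b_def algebra_simps)
  then have main: "2 * (p - 1) * d + 2 * p * (a - b) = p * (N * (p - 1))" by (simp add: algebra_simps)
  have "p dvd d" using dvd p(2) by (simp add: d_def)
  then obtain d' where d': "d = p * d'" by blast
  have d'0: "d' > 0" using d p0 by (simp add: d' zero_less_mult_iff)
  have "N = d' * m" using nm nN d' p0 by simp
  then have d'5: "5 * d' \<le> N" using mult_right_mono[OF m, of d'] d'0 by (simp add: mult.commute)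
  have "N dvd b + d'"
  proof -
    have 1: "N dvd y1 + y2 + y3 + y4" using balanced_dvd_sum[OF baly] dvd_mult_right by blast
    have 2: "N dvd y1 - p * d'"
      using u(2) d' nN by (simp add: y cong_iff_dvd_diff) (meson dvd_mult_right)
    have 3: "N dvd p * e - 1" using e by (simp add: cong_iff_dvd_diff)
    have "e * y2 + e * y3 + e * y4 + d' = e * (y1 + y2 + y3 + y4) - e * (y1 - p * d') - (p * e - 1) * d'"
      by (simp add: algebra_simps)
    then have "N dvd e * y2 + e * y3 + e * y4 + d'" using 1 2 3 by simp
    then show ?thesis by (simp only: b_def dvd_sum_mod_iff)
  qed
  then have b': "N \<le> b + d'" using b d'0 by (intro zdvd_imp_le) auto
  have "p * (2 * ((p - 1) * d' + (a - b))) = p * (N * (p - 1))"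
    using main by (simp add: d' algebra_simps)
  then have "2 * ((p - 1) * d' + (a - b)) = N * (p - 1)" using p0 by simp
  then have "(p - 5) * N + 6 \<le> 2 * (p * d')" using a b' by (simp add: algebra_simps)
  then have "p * ((p - 5) * N + 6) \<le> p * (2 * (p * d'))" using p0 by simp
  then have "(p - 5) * n + 6 * p \<le> 2 * p * d" by (simp add: nN d' algebra_simps)
  then show "(p - 5) * n + 6 * p \<le> 2 * p * gcd x1 n" by (simp only: d_def)
qed

section \<open>Greatest common divisor 5\<close>

lemma mod_eq_if_less_double:
  fixes y N :: int
  shows "0 \<le> y \<Longrightarrow> y < 2 * N \<Longrightarrow> y mod N = (if y < N then y else y - N)"
  using mod_pos_pos_trivial[of y N] mod_pos_pos_trivial[of "y - N" N] by simp

text \<open>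
  Up to exchanging \<open>A\<close> and \<open>B\<close>, the four shift equations force \<open>(A, B, C)\<close> to lie just below
  \<open>(2, 1, 2) * N / 5\<close> or \<open>(3, 1, 1) * N / 5\<close>.
\<close>

definition near_fifths :: "int \<Rightarrow> int \<Rightarrow> int \<Rightarrow> int \<Rightarrow> int \<Rightarrow> bool" where
  "near_fifths N w A B C \<longleftrightarrow> N - 5 * w < 5 * B \<and> 5 * B < N \<and>
     (2 * N - 5 * w < 5 * A \<and> 5 * A < 2 * N \<and> 2 * N - 5 * w < 5 * C \<and> 5 * C < 2 * N \<or>
      3 * N - 5 * w < 5 * A \<and> 5 * A < 3 * N \<and> N - 5 * w < 5 * C \<and> 5 * C < N)"

text \<open>Each argument of \<open>mod\<close> is below \<open>10 * N\<close>, so reduction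
  subtracts \<open>5 * N\<close> at most once, and \<open>A + B + C + w\<close> is \<open>N\<close>,
  \<open>2 * N\<close> or \<open>3 * N\<close>. A finite case split in linear arithmetic
  remains.\<close>

lemma near_fifths_of_shifts:
  fixes A B C N w :: int
  assumes "0 \<le> A" "A < N" "0 \<le> B" "B < N" "0 \<le> C" "C < N" "0 < w" "5 * w < N"
    and "N dvd A + B + C + w"
    and 1: "5 * w + (5 * A + N) mod (5 * N) + (5 * B + N) mod (5 * N) + (5 * C + 3 * N) mod (5 * N) = 10 * N"
    and 2: "5 * w + (5 * A + 2 * N) mod (5 * N) + (5 * B + 2 * N) mod (5 * N) + (5 * C + N) mod (5 * N) = 10 * N"
    and 3: "5 * w + (5 * A + 3 * N) mod (5 * N) + (5 * B + 3 * N) mod (5 * N) + (5 * C + 4 * N) mod (5 * N) = 10 * N"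
    and 4: "5 * w + (5 * A + 4 * N) mod (5 * N) + (5 * B + 4 * N) mod (5 * N) + (5 * C + 2 * N) mod (5 * N) = 10 * N"
  shows "near_fifths N w A B C \<or> near_fifths N w B A C"
proof -
  have m: "y mod (5 * N) = (if y < 5 * N then y else y - 5 * N)" if "0 \<le> y" "y < 10 * N" for y
    using that by (intro mod_eq_if_less_double) auto
  obtain t where t: "A + B + C + w = N * t" using assms(9) by blast
  have "0 < N * t" "N * t < N * 4" using t assms by linarith+
  then have "0 < t" "t < 4" using assms by (simp_all add: zero_less_mult_iff)
  then have t': "A + B + C + w = N \<or> A + B + C + w = 2 * N \<or> A + B + C + w = 3 * N"
    using t by (cases "t = 1"; cases "t = 2"; cases "t = 3") auto
  note e = 1 2 3 4
  have E: "(5 * y + k * N) mod (5 * N) = (if 5 * y + k * N < 5 * N then 5 * y + k * N else 5 * y + k * N - 5 * N)"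
    if "0 \<le> y" "y < N" "k \<in> {2, 3, 4}" for y k
    using that by (intro m) (auto simp: algebra_simps)
  have E1: "(5 * y + N) mod (5 * N) = (if 5 * y + N < 5 * N then 5 * y + N else 5 * y + N - 5 * N)"
    if "0 \<le> y" "y < N" for y
    using that by (intro m) (auto simp: algebra_simps)
  note e' = e[unfolded E[OF assms(1,2), of 2, simplified] E[OF assms(1,2), of 3, simplified] E[OF assms(1,2), of 4, simplified]
     E[OF assms(3,4), of 2, simplified] E[OF assms(3,4), of 3, simplified] E[OF assms(3,4), of 4, simplified]
     E[OF assms(5,6), of 2, simplified] E[OF assms(5,6), of 3, simplified] E[OF assms(5,6), of 4, simplified]
     E1[OF assms(1,2)] E1[OF assms(3,4)] E1[OF assms(5,6)]]
  show ?thesis unfolding near_fifths_def using e' t' assms(1-8)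
    by (smt (verit))
qed

text \<open>The pairs \<open>(k, l)\<close> list the nonzero \<open>k\<close> modulo 5 with
  \<open>l\<close> congruent to \<open>3 * k\<close>; in the application they stand for the four
  units modulo \<open>5 * N\<close> above \<open>v\<close>.\<close>

lemma balanced_triple_near_fifths:
  fixes A B C N v :: int
  assumes N: "N > 0" and dvd: "N dvd A + B + C + 1"
    and v: "coprime v N" "0 < v" "5 * v < N"
    and E: "\<And>k l. (k, l) \<in> {(1, 3), (2, 1), (3, 4), (4, 2)} \<Longrightarrow>
      5 * (v mod N) + (5 * (v * A mod N) + k * N) mod (5 * N)
        + (5 * (v * B mod N) + k * N) mod (5 * N) + (5 * (v * C mod N) + l * N) mod (5 * N) = 10 * N"
  shows "near_fifths N v (v * A mod N) (v * B mod N) (v * C mod N)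
    \<or> near_fifths N v (v * B mod N) (v * A mod N) (v * C mod N)"
proof -
  have vm: "v mod N = v" using v by simp
  have "N dvd v * (A + B + C + 1)" using dvd by simp
  then have d: "N dvd v * A mod N + v * B mod N + v * C mod N + v"
    by (simp only: dvd_sum_mod_iff) (simp add: distrib_left)
  define a b c where abc: "a = v * A mod N" "b = v * B mod N" "c = v * C mod N"
  have bounds: "0 \<le> a" "a < N" "0 \<le> b" "b < N" "0 \<le> c" "c < N" using N by (auto simp: abc)
  note e = E[unfolded vm, folded abc]
  show ?thesis unfolding abc[symmetric]
  proof (rule near_fifths_of_shifts[OF bounds v(2,3) d[folded abc]])
    show "5 * v + (5 * a + N) mod (5 * N) + (5 * b + N) mod (5 * N) + (5 * c + 3 * N) mod (5 * N) = 10 * N"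
      using e[of 1 3] by simp
    show "5 * v + (5 * a + 2 * N) mod (5 * N) + (5 * b + 2 * N) mod (5 * N) + (5 * c + N) mod (5 * N) = 10 * N"
      using e[of 2 1] by simp
    show "5 * v + (5 * a + 3 * N) mod (5 * N) + (5 * b + 3 * N) mod (5 * N) + (5 * c + 4 * N) mod (5 * N) = 10 * N"
      using e[of 3 4] by simp
    show "5 * v + (5 * a + 4 * N) mod (5 * N) + (5 * b + 4 * N) mod (5 * N) + (5 * c + 2 * N) mod (5 * N) = 10 * N"
      using e[of 4 2] by simp
  qed
qed

text \<open>In fifths of \<open>N\<close>, the multiplier 3 sends (3, 1, 1) to (4, 3, 3) and the
  multiplier 2 sends (2, 1, 2) to (4, 2, 4). Neither image is admissible, and for large
  \<open>N\<close> the deviations are too small to matter.\<close>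

lemma no_balanced_triple_near_fifths:
  fixes A B C N :: int
  assumes bounds: "0 \<le> A" "A < N" "0 \<le> B" "B < N" "0 \<le> C" "C < N"
    and N: "N > 1" "coprime N 6" "\<not> 5 dvd N"
    and dvd: "N dvd A + B + C + 1"
    and E: "\<And>v k l. coprime v N \<Longrightarrow> (k, l) \<in> {(1, 3), (2, 1), (3, 4), (4, 2)} \<Longrightarrow>
      5 * (v mod N) + (5 * (v * A mod N) + k * N) mod (5 * N)
        + (5 * (v * B mod N) + k * N) mod (5 * N) + (5 * (v * C mod N) + l * N) mod (5 * N) = 10 * N"
    and pin: "near_fifths N 1 A B C"
  shows False
proof -
  have "N \<ge> 5" using factor_ge_5[of N N] N by simp
  moreover have odd: "odd N" and n3: "\<not> 3 dvd N"
    using N(2) coprime_common_divisor[of N 6 2] coprime_common_divisor[of N 6 3] by auto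
  ultimately have N7: "N = 7 \<or> N \<ge> 11" using N(3) by presburger
  have co: "coprime 2 N" "coprime 3 N"
    using N(2) coprime_divisors[of 2 6 N N] coprime_divisors[of 3 6 N N]
    by (simp_all add: coprime_commute)
  obtain c where c: "A + B + C + 1 = N * c" using dvd by blast
  have "0 < N * c" "N * c < N * 2" using pin bounds N(1) unfolding c[symmetric] near_fifths_def by linarith+
  then have "0 < c" "c < 2" using N by (simp_all add: zero_less_mult_iff)
  then have sum: "A + B + C + 1 = N" using c by simp
  have E2: "5 * (2 mod N) + (5 * (2 * A mod N) + 4 * N) mod (5 * N)
      + (5 * (2 * B mod N) + 4 * N) mod (5 * N) + (5 * (2 * C mod N) + 2 * N) mod (5 * N) = 10 * N"
    using E[OF co(1), of 4 2] by simp
  have E3: "5 * (3 mod N) + (5 * (3 * A mod N) + 3 * N) mod (5 * N)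
      + (5 * (3 * B mod N) + 3 * N) mod (5 * N) + (5 * (3 * C mod N) + 4 * N) mod (5 * N) = 10 * N"
    using E[OF co(2), of 3 4] by simp
  show False
  \<comment> \<open>The criterion for the multiplier 3 requires \<open>5 * 3 < N\<close>. Below that
    only 7, 11 and 13 remain, with few candidates, each refuted by \<open>E2\<close> or
    \<open>E3\<close>.\<close>
  proof (cases "N \<ge> 16")
    case False
    then consider "N = 7" | "N = 11" | "N = 13" using N7 odd N(3) n3 by atomize_elim presburger
    then show ?thesis
    proof cases
      case 1
      then have "A = 4 \<and> B = 1 \<and> C = 1" using pin sum unfolding near_fifths_def by presburger
      then show ?thesis using E3 1 by simp
    next
      case 2
      then have "A = 6 \<and> B = 2 \<and> C = 2 \<or> A = 4 \<and> B = 2 \<and> C = 4" using pin sum unfolding near_fifths_def by (smt (verit))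
      then show ?thesis
      proof
        assume "A = 6 \<and> B = 2 \<and> C = 2"
        then show ?thesis using E3 2 by simp
      next
        assume "A = 4 \<and> B = 2 \<and> C = 4"
        then show ?thesis using E2 2 by simp
      qed
    next
      case 3
      then have "A = 5 \<and> B = 2 \<and> C = 5" using pin sum unfolding near_fifths_def by presburger
      then show ?thesis using E2 3 by simp
    qed
  next
    case N16: True
    note m = mod_eq_if_less_double[of _ N]
    \<comment> \<open>Neither triple of fifths is mapped to one of the two by the multiplier 3, respectively 2.\<close>
    show ?thesis
    proof (cases "5 * C < N")
      case True
      then have "3 * A mod N = 3 * A - N" "3 * B mod N = 3 * B"
        using pin bounds N16 m[of "3 * A"] m[of "3 * B"] by (auto simp: near_fifths_def)
      moreover have "near_fifths N 3 (3 * A mod N) (3 * B mod N) (3 * C mod N)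
          \<or> near_fifths N 3 (3 * B mod N) (3 * A mod N) (3 * C mod N)"
        using N16 co(2) by (intro balanced_triple_near_fifths dvd E) auto
      ultimately show ?thesis using pin True N16 unfolding near_fifths_def by linarith
    next
      case False
      then have "2 * A mod N = 2 * A" "2 * B mod N = 2 * B"
        using pin bounds N16 m[of "2 * A"] m[of "2 * B"] by (auto simp: near_fifths_def)
      moreover have "near_fifths N 2 (2 * A mod N) (2 * B mod N) (2 * C mod N)
          \<or> near_fifths N 2 (2 * B mod N) (2 * A mod N) (2 * C mod N)"
        using N16 co(1) by (intro balanced_triple_near_fifths dvd E) auto
      ultimately show ?thesis using pin False N16 unfolding near_fifths_def by linarith
    qed
  qed
qed

lemma no_balanced_triple:
  fixes A B C N :: int
  assumes bounds: "0 \<le> A" "A < N" "0 \<le> B" "B < N" "0 \<le> C" "C < N"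
    and N: "N > 1" "coprime N 6" "\<not> 5 dvd N"
    and dvd: "N dvd A + B + C + 1"
    and E: "\<And>v k l. coprime v N \<Longrightarrow> (k, l) \<in> {(1, 3), (2, 1), (3, 4), (4, 2)} \<Longrightarrow>
      5 * (v mod N) + (5 * (v * A mod N) + k * N) mod (5 * N)
        + (5 * (v * B mod N) + k * N) mod (5 * N) + (5 * (v * C mod N) + l * N) mod (5 * N) = 10 * N"
  shows False
proof -
  have "N \<ge> 5" using factor_ge_5[of N N] N by simp
  then have "N > 5" using N(3) by (cases "N = 5") auto
  then have "near_fifths N 1 (1 * A mod N) (1 * B mod N) (1 * C mod N)
      \<or> near_fifths N 1 (1 * B mod N) (1 * A mod N) (1 * C mod N)"
    by (intro balanced_triple_near_fifths dvd E) auto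
  then have "near_fifths N 1 A B C \<or> near_fifths N 1 B A C" using bounds by simp
  then show False
  proof
    assume "near_fifths N 1 A B C"
    with bounds N dvd E show False by (rule no_balanced_triple_near_fifths)
  next
    assume pin: "near_fifths N 1 B A C"
    show False
    proof (rule no_balanced_triple_near_fifths[OF bounds(3,4,1,2,5,6) N _ _ pin])
      show "N dvd B + A + C + 1" using dvd by (simp add: ac_simps)
      show "5 * (v mod N) + (5 * (v * B mod N) + k * N) mod (5 * N)
        + (5 * (v * A mod N) + k * N) mod (5 * N) + (5 * (v * C mod N) + l * N) mod (5 * N) = 10 * N"
        if "coprime v N" "(k, l) \<in> {(1, 3), (2, 1), (3, 4), (4, 2)}" for v k l
        using E[OF that] by linarith
    qed
  qed
qed

section \<open>Translation by the Chinese remainder theorem\<close>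

text \<open>Units modulo \<open>n\<close> correspond to pairs of a unit \<open>v\<close> modulo
  \<open>N = n div 5\<close> and a nonzero \<open>k\<close> modulo 5. In these coordinates balance
  becomes the system refuted by \<open>no_balanced_triple\<close>, with \<open>A\<close>,
  \<open>B\<close>, \<open>C\<close> the other terms divided by 5 modulo \<open>N\<close>.\<close>

lemma balanced_gcd_5_aux:
  fixes n :: int
  assumes bal: "balanced n x1 x2 x3 x4" and n: "n > 0" "coprime n 6"
    and x1: "gcd x1 n = 5" "\<not> n dvd x1" and x2: "\<not> 5 dvd x2"
    and x23: "[x2 = x3] (mod 5)" and n5: "\<not> 5 dvd n div 5"
  shows False
proof -
  have "5 dvd n" using x1(1) by (metis gcd_dvd2)
  define N where "N = n div 5"
  have nN: "n = 5 * N" using \<open>5 dvd n\<close> by (simp add: N_def)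
  have N0: "N > 0" using n(1) nN by simp
  have "N \<noteq> 1" using x1 nN by (metis gcd_dvd1 mult.right_neutral)
  then have N1: "N > 1" using N0 by simp
  have N6: "coprime N 6" using n(2) nN by simp
  have N5: "\<not> 5 dvd N" using n5 by (simp add: N_def)
  obtain u where u: "coprime u n" "[u * x1 = 5] (mod n)"
    using unit_multiple[of n 1 x1] n(1) x1(1) by auto
  define y1 y2 y3 y4 where y: "y1 = u * x1" "y2 = u * x2" "y3 = u * x3" "y4 = u * x4"
  have baly: "balanced (5 * N) y1 y2 y3 y4"
    unfolding y nN[symmetric] by (rule balanced_mult[OF bal u(1)])
  have p5: "Factorial_Ring.prime (5 :: int)" by simp
  have "\<not> 5 dvd u" using u(1) \<open>5 dvd n\<close> by (auto dest: coprime_common_divisor)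
  then have "\<not> 5 dvd y2" using x2 by (simp add: y prime_dvd_mult_iff[OF p5])
  then have "coprime y2 5" using prime_imp_coprime[OF p5] by (simp add: coprime_commute)
  \<comment> \<open>Scaling by \<open>s\<close> turns \<open>y2\<close>, \<open>y3\<close>,
    \<open>y4\<close> into 1, 1, 3 modulo 5, the 3 because \<open>y1\<close> and the total vanish
    there. Hence \<open>l\<close> is \<open>3 * k\<close> modulo 5.\<close>
  then obtain s where s: "[y2 * s = 1] (mod 5)" using cong_solve_coprime_int by blast
  then have s2: "5 dvd s * y2 - 1" by (simp add: cong_iff_dvd_diff mult.commute)
  have y32: "5 dvd y2 - y3" using x23 by (simp add: y cong_iff_dvd_diff flip: right_diff_distrib)
  have s3: "5 dvd s * y3 - 1"
  proof -
    have eq: "s * y3 - 1 = (s * y2 - 1) - s * (y2 - y3)" by (simp add: algebra_simps)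
    show ?thesis unfolding eq by (rule dvd_diff[OF s2 dvd_mult[OF y32]])
  qed
  have y1: "5 * N dvd y1 - 5" using u(2) by (simp add: y nN cong_iff_dvd_diff)
  have sumy: "5 * N dvd y1 + y2 + y3 + y4" by (rule balanced_dvd_sum[OF baly])
  have s4: "5 dvd s * y4 - 3"
  proof -
    have eq: "s * y4 - 3 = s * (y1 + y2 + y3 + y4) - s * (y1 - 5) - (s * y2 - 1) - (s * y3 - 1) - 5 * (s + 1)"
      by (simp add: algebra_simps)
    show ?thesis unfolding eq
      by (rule dvd_diff[OF dvd_diff[OF dvd_diff[OF dvd_diff[OF
              dvd_mult[OF dvd_mult_left[OF sumy]] dvd_mult[OF dvd_mult_left[OF y1]]] s2] s3] dvd_triv_left])
  qed
  have "\<not> 5 dvd s"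
  proof
    assume "5 dvd s"
    then have "5 dvd s * y2 - (s * y2 - 1)" by (rule dvd_diff[OF dvd_mult2 s2])
    then show False by simp
  qed
  have "coprime 5 N" using N5 prime_imp_coprime[OF p5] by simp
  then obtain e where e: "[5 * e = 1] (mod N)" using cong_solve_coprime_int by blast
  then have e': "N dvd 5 * e - 1" by (simp add: cong_iff_dvd_diff)
  define A B C where ABC: "A = e * y2 mod N" "B = e * y3 mod N" "C = e * y4 mod N"
  show False
  proof (rule no_balanced_triple)
    show "0 \<le> A" "A < N" "0 \<le> B" "B < N" "0 \<le> C" "C < N" using N0 by (auto simp: ABC)
    show "N > 1" "coprime N 6" "\<not> 5 dvd N" by fact+
    have eq: "e * y2 + e * y3 + e * y4 + 1 = e * (y1 + y2 + y3 + y4) - e * (y1 - 5) - (5 * e - 1)"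
      by (simp add: algebra_simps)
    have "N dvd e * y2 + e * y3 + e * y4 + 1" unfolding eq
      by (rule dvd_diff[OF dvd_diff[OF dvd_mult[OF dvd_mult_right[OF sumy]]
              dvd_mult[OF dvd_mult_right[OF y1]]] e'])
    then show "N dvd A + B + C + 1" by (simp only: ABC dvd_sum_mod_iff)
    fix v k l :: int
    assume v: "coprime v N" and kl: "(k, l) \<in> {(1, 3), (2, 1), (3, 4), (4, 2)}"
    \<comment> \<open>By the Chinese remainder theorem \<open>v\<close> and \<open>k\<close> may be chosen independently.\<close>
    define U where "U = 5 * e * v + k * s * N"
    have "coprime U (5 * N)"
    proof -
      have "[U = 1 * v] (mod N)"
      proof -
        have "U - 1 * v = v * (5 * e - 1) + N * (k * s)" by (simp add: U_def algebra_simps)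
        then show ?thesis using e' by (simp add: cong_iff_dvd_diff)
      qed
      then have "coprime U N" using v by (metis cong_imp_coprime cong_sym mult_1)
      moreover have "\<not> 5 dvd k" using kl by auto
      then have "\<not> 5 dvd k * s * N" using \<open>\<not> 5 dvd s\<close> N5 by (simp add: prime_dvd_mult_iff[OF p5])
      then have "\<not> 5 dvd U" by (simp add: U_def dvd_add_right_iff mult.assoc)
      then have "coprime U 5" using prime_imp_coprime[OF p5] by (simp add: coprime_commute)
      ultimately show ?thesis by simp
    qed
    note b = balancedD[OF baly this]
    have U1: "U * y1 mod (5 * N) = 5 * (v mod N)"
    proof -
      obtain c where c: "5 * e - 1 = N * c" using e' by blast
      have "U * y1 - 5 * v = U * (y1 - 5) + 5 * N * (k * s) + 5 * v * (5 * e - 1)"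
        by (simp add: U_def algebra_simps)
      also have "\<dots> = U * (y1 - 5) + 5 * N * (k * s + v * c)"
        unfolding c by (simp add: algebra_simps)
      finally have "5 * N dvd U * y1 - 5 * v" using y1 by simp
      then have "U * y1 mod (5 * N) = 5 * v mod (5 * N)" by (simp only: mod_eq_dvd_iff)
      then show ?thesis by (simp only: mult_mod_right)
    qed
    \<comment> \<open>In \<open>U * z\<close> the coefficient \<open>k * s * z\<close> of
      \<open>N\<close> matters only modulo 5, so \<open>j\<close> may replace it.\<close>
    have Ui: "U * z mod (5 * N) = (5 * (v * (e * z mod N) mod N) + j * N) mod (5 * N)"
      if dv: "5 dvd k * (s * z) - j" for z j
    proof -
      obtain c where c: "k * (s * z) - j = 5 * c" using dv by blast
      have "U * z = 5 * (v * (e * z)) + j * N + N * (k * (s * z) - j)"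
        by (simp add: U_def algebra_simps)
      also have "\<dots> = (5 * (v * (e * z)) + j * N) + (5 * N) * c" unfolding c by simp
      finally have "U * z mod (5 * N) = (5 * (v * (e * z)) + j * N) mod (5 * N)"
        by (simp only: mod_mult_self2)
      also have "\<dots> = (5 * (v * (e * z)) mod (5 * N) + j * N) mod (5 * N)"
        by (simp only: mod_add_left_eq)
      also have "5 * (v * (e * z)) mod (5 * N) = 5 * (v * (e * z mod N) mod N)"
        by (simp only: mult_mod_right[symmetric] mod_mult_right_eq)
      finally show ?thesis .
    qed
    have k1: "5 dvd k * x - k" if "5 dvd x - 1" for x
      using dvd_mult[OF that, of k] by (simp add: right_diff_distrib)
    have k3: "5 dvd k * (s * y4) - l"
    proof -
      have "5 dvd 3 * k - l" using kl by auto
      moreover have eq: "k * (s * y4) - l = k * (s * y4 - 3) + (3 * k - l)" by (simp add: algebra_simps)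
      ultimately show ?thesis unfolding eq by (intro dvd_add dvd_mult[OF s4])
    qed
    show "5 * (v mod N) + (5 * (v * A mod N) + k * N) mod (5 * N)
        + (5 * (v * B mod N) + k * N) mod (5 * N) + (5 * (v * C mod N) + l * N) mod (5 * N) = 10 * N"
      using b unfolding U1 Ui[OF k1[OF s2]] Ui[OF k1[OF s3]] Ui[OF k3] ABC by simp
  qed
qed

text \<open>Three distinct nonzero residues modulo 5 sum to minus the missing one, which is not 0.
  So two of \<open>x2\<close>, \<open>x3\<close>, \<open>x4\<close> agree modulo 5, and a
  permutation puts them first.\<close>

lemma balanced_gcd_5:
  fixes n :: int
  assumes bal: "balanced n x1 x2 x3 x4" and n: "n > 0" "coprime n 6"
    and x1: "gcd x1 n = 5" "\<not> n dvd x1" and x: "\<not> 5 dvd x2" "\<not> 5 dvd x3" "\<not> 5 dvd x4"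
    and n5: "\<not> 5 dvd n div 5"
  shows False
proof -
  have "5 dvd n" "5 dvd x1" using x1(1) by (metis gcd_dvd2, metis gcd_dvd1)
  then have "5 dvd x2 + x3 + x4"
    using balanced_dvd_sum[OF bal] by (metis add.assoc dvd_add_right_iff dvd_trans)
  then have "5 dvd x2 mod 5 + x3 mod 5 + x4 mod 5"
    using dvd_sum_mod_iff[of 5 x2 x3 x4 0] by simp
  moreover have "y mod 5 = 1 \<or> y mod 5 = 2 \<or> y mod 5 = 3 \<or> y mod 5 = 4" if "\<not> 5 dvd y" for y :: int
    using that by presburger
  note this[OF x(1)] this[OF x(2)] this[OF x(3)]
  ultimately have "[x2 = x3] (mod 5) \<or> [x2 = x4] (mod 5) \<or> [x3 = x4] (mod 5)"
    unfolding cong_def by auto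
  moreover have "balanced n x1 x2 x4 x3" "balanced n x1 x3 x4 x2"
    using bal by (simp_all add: balanced_def algebra_simps)
  ultimately show False
    using balanced_gcd_5_aux[OF bal n x1 x(1) _ n5] balanced_gcd_5_aux[OF _ n x1 x(1) _ n5]
      balanced_gcd_5_aux[OF _ n x1 x(2) _ n5] by blast
qed

section \<open>Units with residue sum equal to the modulus\<close>

text \<open>The inequality of \<open>balanced_one_dvd\<close> applies to every prime dividing
  \<open>gcd x1 n\<close> and leaves 5 and 7. Size and parity dispose of 7, and the gcd 5 is treated
  separately.\<close>

lemma balanced_gcd_eq_1:
  fixes n :: int
  assumes bal: "balanced n x1 x2 x3 x4" and n: "n > 0" "coprime n 6"
    and nx1: "\<not> n dvd x1"
    and pairs: "\<not> n dvd x1 + x2" "\<not> n dvd x1 + x3" "\<not> n dvd x1 + x4"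
    and no_common: "\<And>p. Factorial_Ring.prime p \<Longrightarrow> p dvd n \<Longrightarrow> p dvd x1 \<Longrightarrow> p dvd x2 \<Longrightarrow> p dvd x3 \<Longrightarrow> \<not> p dvd x4"
  shows "gcd x1 n = 1"
proof (rule ccontr)
  assume g1: "gcd x1 n \<noteq> 1"
  define g where "g = gcd x1 n"
  \<comment> \<open>A prime dividing \<open>x1\<close> and two further terms divides the fourth
    through the sum, against \<open>no_common\<close>; with exactly one further term,
    \<open>balanced_two_dvd\<close> applies.\<close>
  have only: "\<not> p dvd x2 \<and> \<not> p dvd x3 \<and> \<not> p dvd x4"
    if p: "Factorial_Ring.prime p" "p dvd n" "p dvd x1" for p
  proof -
    have sum: "p dvd x1 + x2 + x3 + x4" using balanced_dvd_sum[OF bal] p(2) by (rule dvd_trans[rotated])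
    have bals: "balanced n x1 x3 x2 x4" "balanced n x1 x4 x2 x3"
      using bal by (simp_all add: balanced_def algebra_simps)
    have third: "p dvd c" if "p dvd x1 + a + b + c" "p dvd a" "p dvd b" for a b c
    proof -
      have "c = (x1 + a + b + c) - x1 - a - b" by simp
      then show ?thesis using that p(3) by (metis dvd_diff)
    qed
    have 23: "\<not> (p dvd x2 \<and> p dvd x3)" using third[of x2 x3 x4] sum no_common[OF p] by blast
    have 24: "\<not> (p dvd x2 \<and> p dvd x4)" using third[of x2 x4 x3] sum no_common[OF p] by (auto simp: ac_simps)
    have 34: "\<not> (p dvd x3 \<and> p dvd x4)" using third[of x3 x4 x2] sum no_common[OF p] by (auto simp: ac_simps)
    have "\<not> p dvd x2" using balanced_two_dvd[OF bal n p(1,2,3) _ _ _ pairs(1)] 23 24 by blast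
    moreover have "\<not> p dvd x3" using balanced_two_dvd[OF bals(1) n p(1,2,3) _ _ _ pairs(2)] 23 34 by blast
    moreover have "\<not> p dvd x4" using balanced_two_dvd[OF bals(2) n p(1,2,3) _ _ _ pairs(3)] 24 34 by blast
    ultimately show ?thesis by blast
  qed
  have g: "g > 0" using n(1) by (simp add: g_def)
  have "g dvd n" by (simp add: g_def)
  then obtain m where m: "n = g * m" by blast
  have "m > 0" using m n(1) g by (simp add: zero_less_mult_iff)
  moreover have "m \<noteq> 1" using m nx1 by (metis g_def gcd_dvd1 mult.right_neutral)
  ultimately have m5: "m \<ge> 5" using factor_ge_5[OF n(2), of m] m by auto
  have g5: "5 * g \<le> n" using mult_left_mono[OF m5, of g] g m by simp
  have odd: "odd n" using n(2) coprime_common_divisor[of n 6 2] by auto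
  have step: "(p = 5 \<or> p = 7) \<and> \<not> p * p dvd n \<and> (p - 5) * n + 6 * p \<le> 2 * p * g"
    if p: "Factorial_Ring.prime p" "p dvd g" for p
  proof -
    have pn: "p dvd n" "p dvd x1" using p(2) by (simp_all add: g_def)
    note o = only[OF p(1) pn]
    note B = balanced_one_dvd[OF bal n p(1) pn o[THEN conjunct1] o[THEN conjunct2, THEN conjunct1]
        o[THEN conjunct2, THEN conjunct2] nx1]
    have p5: "p \<ge> 5" using factor_ge_5[OF n(2) pn(1)] prime_gt_1_int[OF p(1)] by simp
    \<comment> \<open>Together with the inequality this yields \<open>5 * (p - 5) < 2 * p\<close>,
      that is \<open>3 * p < 25\<close>.\<close>
    have "(p - 5) * (5 * g) \<le> (p - 5) * n" using p5 g5 by (intro mult_left_mono) auto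
    then have "(p - 5) * (5 * g) < 2 * p * g" using B(2) p5 by (simp add: g_def)
    then have "g * (3 * p) < g * 25" by (simp add: algebra_simps)
    then have "p < 9" using g by simp
    then have "p = 5 \<or> p = 6 \<or> p = 7 \<or> p = 8" using p5 by auto
    moreover have "odd p" using odd pn(1) dvd_trans by blast
    then have "p \<noteq> 6" "p \<noteq> 8" by auto
    moreover have "\<not> p * p dvd n" using B(1) p5 by (auto elim!: dvdE simp: mult.assoc)
    ultimately show ?thesis using B(2) by (simp add: g_def)
  qed
  have quot: "\<exists>q. Factorial_Ring.prime q \<and> p * q dvd g" if p: "p dvd g" "p > 0" "g \<noteq> p" for p
  proof -
    obtain g' where g': "g = p * g'" using p(1) by blast
    have "g' > 0" "g' \<noteq> 1" using p g g' by (auto simp: zero_less_mult_iff)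
    then obtain q where "Factorial_Ring.prime q" "q dvd g'" using prime_divisor_exists[of g'] by auto
    then show ?thesis using g' by auto
  qed
  have sq: "\<not> p * p dvd g" if "Factorial_Ring.prime p" for p
    using step[OF that] \<open>g dvd n\<close> by (meson dvd_mult_left dvd_trans)
  show False
  proof (cases "7 dvd g")
    case True
    then have "2 * n + 42 \<le> 14 * g" using step[of 7] by simp
    then have mg: "g * m + 21 \<le> 7 * g" using m by simp
    then have "g * m < g * 7" by simp
    then have "m < 7" using g by simp
    moreover have "m \<noteq> 6" using odd m by auto
    ultimately have m: "m = 5" using m5 by simp
    then have "g \<noteq> 7" using mg by auto
    \<comment> \<open>A further prime in \<open>g\<close> can only be 5, as 49 does not divide
      \<open>g\<close>; but then \<open>m = 5\<close> puts 25 into \<open>n\<close>.\<close>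
    then obtain q where q: "Factorial_Ring.prime q" "7 * q dvd g" using quot[of 7] True by auto
    have "q \<noteq> 7" using q(2) sq[of 7] by auto
    then have "q = 5" using step[of q] q dvd_mult_right by blast
    then have "5 * 5 dvd n" using q(2) \<open>n = g * m\<close> m dvd_mult_right by (metis mult_dvd_mono dvd_refl)
    moreover have "5 dvd g" using q(2) \<open>q = 5\<close> dvd_mult_right by blast
    ultimately show False using step[of 5] by simp
  next
    case False
    have five: "q = 5" if "Factorial_Ring.prime q" "q dvd g" for q
      using step[OF that] False that by auto
    obtain q where "Factorial_Ring.prime q" "q dvd g" using quot[of 1] g1 by (auto simp: g_def)
    then have "5 dvd g" using five by blast
    have "g = 5"
    proof (rule ccontr)
      assume "g \<noteq> 5"
      then obtain q where q: "Factorial_Ring.prime q" "5 * q dvd g" using quot[of 5] \<open>5 dvd g\<close> by auto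
      then have "q = 5" using five dvd_mult_right by blast
      then show False using q sq by blast
    qed
    have n5: "5 dvd n" "5 dvd x1" using \<open>5 dvd g\<close> by (simp_all add: g_def)
    have "\<not> 5 * 5 dvd n" using step[of 5] \<open>5 dvd g\<close> by simp
    then have "\<not> 5 dvd n div 5" using n5(1) by (auto elim!: dvdE)
    then show False
      using balanced_gcd_5[OF bal n _ nx1 _ _ _] only[OF _ n5] \<open>g = 5\<close> by (simp add: g_def)
  qed
qed

text \<open>The residues are nonzero, so their sum is a multiple of \<open>n\<close> strictly
  between 0 and \<open>4 * n\<close>. A sum \<open>3 * n\<close> becomes \<open>n\<close> under
  \<open>- u\<close>, which turns each residue \<open>r\<close> into \<open>n - r\<close>.\<close>

lemma not_balanced_imp_sum_mod_eq:
  fixes n :: int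
  assumes "\<not> balanced n x1 x2 x3 x4" "n > 0" "n dvd x1 + x2 + x3 + x4"
    and x: "\<not> n dvd x1" "\<not> n dvd x2" "\<not> n dvd x3" "\<not> n dvd x4"
  shows "\<exists>u. coprime u n \<and> u * x1 mod n + u * x2 mod n + u * x3 mod n + u * x4 mod n = n"
proof -
  obtain u where u: "coprime u n" and ne: "u * x1 mod n + u * x2 mod n + u * x3 mod n + u * x4 mod n \<noteq> 2 * n"
    using assms(1) by (auto simp: balanced_def)
  define S where "S = u * x1 mod n + u * x2 mod n + u * x3 mod n + u * x4 mod n"
  have nd: "u * x mod n \<noteq> 0" if "\<not> n dvd x" for x
    using that u by (metis coprime_commute coprime_dvd_mult_right_iff dvd_eq_mod_eq_0)
  have bd: "0 < u * x mod n" "u * x mod n < n" if "\<not> n dvd x" for x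
    using nd[OF that] assms(2) pos_mod_sign[of n "u * x"] by (auto simp: le_less)
  have "0 < S" "S < 4 * n" unfolding S_def using bd[OF x(1)] bd[OF x(2)] bd[OF x(3)] bd[OF x(4)] by linarith+
  moreover have "n dvd u * (x1 + x2 + x3 + x4)" using assms(3) by simp
  then have "n dvd u * x1 + u * x2 + u * x3 + u * x4 mod n"
    using dvd_sum_mod_iff[of n "u * x4" 0 0 "u * x1 + u * x2 + u * x3"] by (simp add: algebra_simps)
  then have "n dvd S"
    unfolding S_def by (simp only: dvd_sum_mod_iff)
  then obtain c where c: "S = n * c" by blast
  ultimately have "0 < n * c" "n * c < n * 4" by linarith+
  then have "0 < c" "c < 4" using assms(2) zero_less_mult_pos mult_less_cancel_left_pos by blast+
  then have "c = 1 \<or> c = 2 \<or> c = 3" by linarith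
  then have "S = n \<or> S = 3 * n" using c ne S_def by auto
  then show ?thesis
  proof
    assume "S = n"
    then show ?thesis unfolding S_def using u by (intro exI[of _ u] conjI)
  next
    assume S: "S = 3 * n"
    have neg: "- u * x mod n = n - u * x mod n" if "\<not> n dvd x" for x
      using nd[OF that] by (simp add: zmod_zminus1_eq_if)
    have "- u * x1 mod n + - u * x2 mod n + - u * x3 mod n + - u * x4 mod n = n"
      unfolding neg[OF x(1)] neg[OF x(2)] neg[OF x(3)] neg[OF x(4)] using S S_def by linarith
    moreover have "coprime (- u) n" using u by simp
    ultimately show ?thesis by blast
  qed
qed

lemma exists_unit_sum_mod_eq:
  fixes n :: int
  assumes n: "n > 0" "coprime n 6" and sum: "n dvd x1 + x2 + x3 + x4"
    and x: "\<not> n dvd x1" "\<not> n dvd x2" "\<not> n dvd x3" "\<not> n dvd x4"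
    and pairs: "\<not> n dvd x1 + x2" "\<not> n dvd x1 + x3" "\<not> n dvd x1 + x4"
      "\<not> n dvd x2 + x3" "\<not> n dvd x2 + x4" "\<not> n dvd x3 + x4"
    and no_common: "\<And>p. Factorial_Ring.prime p \<Longrightarrow> p dvd n \<Longrightarrow> p dvd x1 \<Longrightarrow> p dvd x2 \<Longrightarrow> p dvd x3 \<Longrightarrow> \<not> p dvd x4"
    and ex: "\<exists>y \<in> {x1, x2, x3, x4}. gcd y n \<noteq> 1"
  shows "\<exists>u. coprime u n \<and> u * x1 mod n + u * x2 mod n + u * x3 mod n + u * x4 mod n = n"
proof (rule not_balanced_imp_sum_mod_eq[OF _ n(1) sum x])
  show "\<not> balanced n x1 x2 x3 x4"
  proof
    assume bal: "balanced n x1 x2 x3 x4"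
    have "balanced n x2 x1 x3 x4" "balanced n x3 x1 x2 x4" "balanced n x4 x1 x2 x3"
      using bal by (simp_all add: balanced_def algebra_simps)
    note bals = this
    have "gcd x1 n = 1"
      by (rule balanced_gcd_eq_1[OF bal n x(1)]) (use pairs no_common in auto)
    moreover have "gcd x2 n = 1"
      by (rule balanced_gcd_eq_1[OF bals(1) n x(2)]) (use pairs no_common in \<open>auto simp: add.commute\<close>)
    moreover have "gcd x3 n = 1"
      by (rule balanced_gcd_eq_1[OF bals(2) n x(3)]) (use pairs no_common in \<open>auto simp: add.commute\<close>)
    moreover have "gcd x4 n = 1"
      by (rule balanced_gcd_eq_1[OF bals(3) n x(4)]) (use pairs no_common in \<open>auto simp: add.commute\<close>)
    ultimately show False using ex by auto
  qed
qed

section \<open>Zero-sum sequences over cyclic groups\<close>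

lemma (in group) generators_iff_ord:
  assumes "finite (carrier G)"
  shows "h \<in> generators G \<longleftrightarrow> h \<in> carrier G \<and> ord h = order G"
  using assms generate_incl[of "{h}"] card_subset_eq[of "carrier G" "generate G {h}"]
  by (auto simp: generators_def generate_pow_card order_def)

lemma (in group) pow_mod_ord:
  assumes "a \<in> carrier G"
  shows "a [^] (k mod ord a) = a [^] (k :: nat)"
proof -
  have "a [^] (ord a * (k div ord a)) \<otimes> a [^] (k mod ord a) = a [^] k"
    using assms by (simp add: nat_pow_mult)
  then show ?thesis using assms by (simp add: nat_pow_pow[symmetric])
qed

lemma (in group) coefficient_generator:
  assumes "finite (carrier G)" "h \<in> generators G" "a \<in> carrier G"
  shows "coefficient G h a \<in> {1..order G}" "h [^] coefficient G h a = a"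
proof -
  have h: "h \<in> carrier G" "ord h = order G" and gen: "generate G {h} = carrier G"
    using assms(2) generators_iff_ord[OF assms(1)] unfolding generators_def by blast+
  have o: "order G > 0" using assms(1) by (simp add: order_gt_0_iff_finite)
  obtain k :: nat where k: "a = h [^] k"
    using generate_pow_on_finite_carrier[OF assms(1) h(1)] gen assms(3) by auto
  \<comment> \<open>Coefficients start at 1, so the identity gets \<open>order G\<close> instead of
    0.\<close>
  define j where "j = (if order G dvd k then order G else k mod order G)"
  have "j \<in> {1..order G}" using o mod_greater_zero_iff_not_dvd[of k "order G"] by (auto simp: j_def)
  moreover have "h [^] j = a"
  proof (cases "order G dvd k")
    case True
    then show ?thesis using pow_eq_id[OF h(1), of k] pow_eq_id[OF h(1), of "order G"] h(2) by (simp add: j_def k)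
  next
    case False
    then show ?thesis using pow_mod_ord[OF h(1), of k] h(2) by (simp add: j_def k)
  qed
  ultimately show "coefficient G h a \<in> {1..order G}" "h [^] coefficient G h a = a"
    using coefficient_eqI[OF assms(1,2), of j a] by auto
qed

lemma (in comm_group) pow_sum_coefficient:
  assumes "finite (carrier G)" "h \<in> generators G"
  shows "set_mset S \<subseteq> carrier G \<Longrightarrow> h [^] (\<Sum>a\<in>#S. coefficient G h a) = seq_sum G S"
proof (induction S)
  case empty
  then show ?case by (simp add: seq_sum_empty)
next
  case (add a S)
  have "h \<in> carrier G" using assms(2) by (simp add: generators_def)
  then show ?case
    using add coefficient_generator(2)[OF assms, of a]
    by (simp add: seq_sum_add_mset nat_pow_mult[symmetric])
qed

text \<open>The coefficients sum to an exponent at which \<open>h\<close> gives the identity, hence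
  to a multiple of \<open>ord h\<close>, positive because \<open>S\<close> is nonempty. One
  generator of norm 1 thus settles the index.\<close>

lemma (in comm_group) seq_norm_ge_1:
  assumes "finite (carrier G)" "h \<in> generators G" "zero_sum G S" "S \<noteq> {#}"
  shows "seq_norm G h S \<ge> 1"
proof -
  have h: "h \<in> carrier G" "ord h = order G" using assms by (auto simp: generators_iff_ord)
  have S: "set_mset S \<subseteq> carrier G" "seq_sum G S = \<one>" using assms(3) by (auto simp: zero_sum_def)
  obtain a T where aT: "S = add_mset a T" using assms(4) by (cases S) auto
  have "coefficient G h a \<ge> 1" using coefficient_generator(1)[OF assms(1,2), of a] S aT by simp
  then have pos: "(\<Sum>a\<in>#S. coefficient G h a) > 0" by (simp add: aT)
  have "ord h dvd (\<Sum>a\<in>#S. coefficient G h a)"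
    using pow_sum_coefficient[OF assms(1,2) S(1)] S(2) pow_eq_id[OF h(1)] by simp
  then have "ord h \<le> (\<Sum>a\<in>#S. coefficient G h a)" using pos by (rule dvd_imp_le)
  moreover have "ord h > 0" using h assms(1) by (simp add: order_gt_0_iff_finite)
  ultimately show ?thesis by (simp add: seq_norm_def del: of_nat_sum_mset)
qed

lemma (in comm_group) seq_index_eq_1I:
  assumes "finite (carrier G)" "zero_sum G S" "S \<noteq> {#}" "h \<in> generators G" "seq_norm G h S = 1"
  shows "seq_index G S = 1"
  unfolding seq_index_def
proof (rule Min_eqI)
  show "finite ((\<lambda>h. seq_norm G h S) ` generators G)"
    using assms(1) by (simp add: generators_def)
  show "1 \<in> (\<lambda>h. seq_norm G h S) ` generators G" using assms(4,5) by force
qed (use seq_norm_ge_1 assms in auto)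

text \<open>Taking a multiset of exponents lets the rule serve both the whole sequence and its
  two-term subsequences.\<close>

lemma (in comm_group) zero_sum_pow_iff:
  assumes "g \<in> carrier G"
  shows "zero_sum G (image_mset (\<lambda>x. g [^] x) M) \<longleftrightarrow> ord g dvd \<Sum>\<^sub># M"
proof -
  have "seq_sum G (image_mset (\<lambda>x. g [^] x) M) = g [^] \<Sum>\<^sub># M"
  proof (induction M)
    case empty
    show ?case by (simp add: seq_sum_empty)
  next
    case (add x M)
    have "set_mset (image_mset (\<lambda>x. g [^] x) M) \<subseteq> carrier G" using assms by auto
    then show ?case using add assms by (simp add: seq_sum_add_mset nat_pow_mult)
  qed
  then show ?thesis using assms by (auto simp: zero_sum_def pow_eq_id)
qed

text \<open>As \<open>u * v\<close> is 1 modulo the order, \<open>x\<close> is congruent to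
  \<open>v * (u * x)\<close>. Excluding multiples of the order keeps the residue nonzero; residue 0
  would mean the coefficient \<open>order G\<close>.\<close>

lemma (in group) coefficient_pow_unit:
  assumes "finite (carrier G)" "g \<in> carrier G" "ord g = order G" "order G > 1"
    and uv: "[u * v = 1] (mod order G)" and x: "\<not> order G dvd x"
  shows "g [^] v \<in> generators G" "coefficient G (g [^] v) (g [^] x) = u * x mod order G"
proof -
  have "[v * u = Suc 0] (mod order G)" using uv by (simp add: mult.commute)
  then have v: "coprime v (order G)" using coprime_iff_invertible_nat by blast
  have "v \<noteq> 0"
  proof
    assume "v = 0"
    then show False using v assms(4) by simp
  qed
  moreover have "gcd (order G) v = 1" using v by (simp add: coprime_commute)
  ultimately show gen: "g [^] v \<in> generators G"
    using assms(2,3) by (simp add: generators_iff_ord[OF assms(1)] ord_pow_gen)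
  have u: "coprime u (order G)" using uv coprime_iff_invertible_nat by auto
  then have "\<not> order G dvd u * x" using x by (simp add: coprime_commute coprime_dvd_mult_right_iff)
  then have "u * x mod order G \<in> {1..order G}"
    using assms(4) by (auto simp: mod_greater_zero_iff_not_dvd Suc_le_eq)
  moreover have "(g [^] v) [^] (u * x mod order G) = g [^] x"
  proof -
    have "[v * (u * x mod order G) = v * (u * x)] (mod order G)" by (simp add: cong_def mod_simps)
    also have "[v * (u * x) = (u * v) * x] (mod order G)" by (simp add: ac_simps)
    also have "[(u * v) * x = 1 * x] (mod order G)" using uv by (rule cong_scalar_right)
    finally have "[v * (u * x mod order G) = x] (mod ord g)" by (simp add: assms(3))
    then have "g [^] (v * (u * x mod order G)) = g [^] x" using pow_mod_ord[OF assms(2)] by (metis cong_def)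
    then show ?thesis using assms(2) by (simp add: nat_pow_pow)
  qed
  ultimately show "coefficient G (g [^] v) (g [^] x) = u * x mod order G"
    by (intro coefficient_eqI[OF assms(1) gen])
qed

theorem theorem1p3:
  fixes G :: "('a, 'b) monoid_scheme" and g :: 'a and n x1 x2 x3 x4 :: nat
  assumes "n > 0" and "gcd n 6 = 1"
    and "group G" and "cyclic_group G" and "order G = n"
    and "g \<in> carrier G" and "group.ord G g = n"
    and "{x1, x2, x3, x4} \<subseteq> {1..n - 1}"
    and "Gcd {n, x1, x2, x3, x4} = 1"
    and "minimal_zero_sum G {#g [^]\<^bsub>G\<^esub> x1, g [^]\<^bsub>G\<^esub> x2, g [^]\<^bsub>G\<^esub> x3, g [^]\<^bsub>G\<^esub> x4#}"
    and "\<exists>x \<in> {x1, x2, x3, x4}. gcd n x > 1"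
  shows "seq_index G {#g [^]\<^bsub>G\<^esub> x1, g [^]\<^bsub>G\<^esub> x2, g [^]\<^bsub>G\<^esub> x3, g [^]\<^bsub>G\<^esub> x4#} = 1"
proof -
  interpret group G by fact
  interpret comm_group G by (rule cyclic_imp_abelian_group) fact
  have fin: "finite (carrier G)" using assms(1,5) by (simp add: order_gt_0_iff_finite[symmetric])
  let ?S = "{#g [^]\<^bsub>G\<^esub> x1, g [^]\<^bsub>G\<^esub> x2, g [^]\<^bsub>G\<^esub> x3, g [^]\<^bsub>G\<^esub> x4#}"
  have S: "zero_sum G ?S" using assms(10) by (simp add: minimal_zero_sum_def)
  have zs: "zero_sum G (image_mset (\<lambda>x. g [^]\<^bsub>G\<^esub> x) M) \<longleftrightarrow> n dvd \<Sum>\<^sub># M" for M :: "nat multiset"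
    using zero_sum_pow_iff[OF assms(6), of M] assms(7) by simp
  have sum: "n dvd x1 + x2 + x3 + x4"
    using S zs[of "{#x1, x2, x3, x4#}"] by (simp add: add.assoc)
  \<comment> \<open>Minimality enters through two-term subsequences; \<open>eq\<close> lets one
    argument cover all six pairs.\<close>
  have pair: "\<not> n dvd x + y" if eq: "{#x1, x2, x3, x4#} = {#x, y#} + {#z, t#}" for x y z t
  proof
    assume "n dvd x + y"
    then have "zero_sum G {#g [^]\<^bsub>G\<^esub> x, g [^]\<^bsub>G\<^esub> y#}" using zs[of "{#x, y#}"] by simp
    moreover have "?S = {#g [^]\<^bsub>G\<^esub> x, g [^]\<^bsub>G\<^esub> y#} + {#g [^]\<^bsub>G\<^esub> z, g [^]\<^bsub>G\<^esub> t#}"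
      using arg_cong[OF eq, of "image_mset (\<lambda>x. g [^]\<^bsub>G\<^esub> x)"] by simp
    then have "{#g [^]\<^bsub>G\<^esub> x, g [^]\<^bsub>G\<^esub> y#} \<subset># ?S" by (simp add: subset_mset_def)
    ultimately show False using assms(10) by (auto simp: minimal_zero_sum_def)
  qed
  have "\<not> n dvd x1 + x2" "\<not> n dvd x1 + x3" "\<not> n dvd x1 + x4"
    "\<not> n dvd x2 + x3" "\<not> n dvd x2 + x4" "\<not> n dvd x3 + x4"
    using pair[of x1 x2 x3 x4] pair[of x1 x3 x2 x4] pair[of x1 x4 x2 x3]
      pair[of x2 x3 x1 x4] pair[of x2 x4 x1 x3] pair[of x3 x4 x1 x2]
    by (simp_all add: add_mset_commute)
  then have pairs: "\<not> int n dvd int x1 + int x2" "\<not> int n dvd int x1 + int x3" "\<not> int n dvd int x1 + int x4"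
    "\<not> int n dvd int x2 + int x3" "\<not> int n dvd int x2 + int x4" "\<not> int n dvd int x3 + int x4"
    by (simp_all flip: of_nat_add)
  have nx: "\<not> n dvd x" if "x \<in> {x1, x2, x3, x4}" for x
    using that assms(8) by (auto dest!: dvd_imp_le)
  have no_common: "\<not> p dvd int x4"
    if "Factorial_Ring.prime p" "p dvd int n" "p dvd int x1" "p dvd int x2" "p dvd int x3" for p
  proof
    assume "p dvd int x4"
    then have "nat \<bar>p\<bar> dvd Gcd {n, x1, x2, x3, x4}"
      using that by (intro Gcd_greatest) (auto simp: nat_abs_dvd_iff)
    then have "nat \<bar>p\<bar> = 1" by (simp only: assms(9) nat_dvd_1_iff_1)
    then show False using prime_gt_1_int[OF that(1)] by simp
  qed
  have ex: "\<exists>y \<in> {int x1, int x2, int x3, int x4}. gcd y (int n) \<noteq> 1"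
    using assms(11) by (auto simp: gcd.commute)
  have "coprime (int n) 6" using assms(2) by (metis coprime_iff_gcd_eq_1 gcd_int_int_eq of_nat_1 of_nat_numeral)
  then obtain u where u: "coprime u (int n)"
    "u * x1 mod n + u * x2 mod n + u * x3 mod n + u * x4 mod n = int n"
    using exists_unit_sum_mod_eq[of "int n" "int x1" "int x2" "int x3" "int x4", OF _ _ _ _ _ _ _ pairs no_common ex]
      assms(1) sum nx by (auto simp flip: of_nat_add)
  \<comment> \<open>The integer \<open>u\<close> may be negative, so a natural representative
    \<open>w\<close> replaces it; its inverse \<open>v\<close> yields the generator whose
    coefficients are the residues \<open>w * x mod n\<close>.\<close>
  define w where "w = nat (u mod int n)"
  have w: "int w = u mod int n" using assms(1) by (simp add: w_def)
  have "coprime (int w) (int n)" unfolding w using u(1) assms(1) by (subst coprime_mod_left_iff) auto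
  then have "coprime w n" by simp
  then obtain v where wv: "[w * v = 1] (mod n)" using cong_solve_coprime_nat by auto
  have "int (w * x mod n) = u * int x mod int n" for x
    by (simp add: of_nat_mod w mod_mult_left_eq)
  then have "int (w * x1 mod n + w * x2 mod n + w * x3 mod n + w * x4 mod n) = int n"
    using u(2) by simp
  then have total: "w * x1 mod n + w * x2 mod n + w * x3 mod n + w * x4 mod n = n" by linarith
  have n1: "n > 1" using assms(8) by auto
  note c = coefficient_pow_unit[of g w v, OF fin assms(6), unfolded assms(5,7), OF refl n1 wv]
  show ?thesis
  proof (rule seq_index_eq_1I[OF fin S])
    show "g [^]\<^bsub>G\<^esub> v \<in> generators G" using c(1) nx by blast
    moreover from this have "group.ord G (g [^]\<^bsub>G\<^esub> v) = n" using generators_iff_ord[OF fin] assms(5) by simp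
    ultimately show "seq_norm G (g [^]\<^bsub>G\<^esub> v) ?S = 1"
      using c(2)[OF nx] total n1 by (simp add: seq_norm_def add.assoc flip: of_nat_add)
  qed simp
qed

end
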